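(* Let $\Phi$ be a virtually Abelian group and $\tilde{\Phi} \leq \Phi$ a normal Abelian subgroup of index $k < \infty$. Let $S \subset \Phi$ be a finite, symmetric generating set of $\Phi$ and denote by $G = \mathrm{Cay}(\Phi,S)$ the associated Cayley graph. Similarly, let $\tilde{S} \subset \tilde{\Phi}$ be a finite, symmetric generating set of $\tilde{\Phi}$ that is invariant under conjugation by elements of $\Phi$. Then there exists a constant $C > 0$ such that for any solution $w : G \times [0,\infty) \to [0,1]$ of the heat equation $\Delta w = \partial_t w$ on $G$, the shifted solution $u = w + \sqrt{k}$ satisfies $$-\tilde{\Delta} \log u \leq \frac{C}{t}$$ at every $x \in G$ and every $t > 0$.
   Context: Edges of Cayley graphs are given by right multiplication by generators: $x$ is adjacent to $x*s$, $s \in S$. The graph $\tilde{G} = \mathrm{Cay}(\Phi, \tilde{S})$ has the same vertex set $\Phi$ as $G$, with edges given by right multiplication by elements of $\tilde{S}$. For a locally finite graph $G$ and a function $f$ on its vertices, $\Delta f(x) = \Delta_G f(x) = \sum_{y \sim x} (f(y) - f(x))$. Write $\tilde{\Delta} = \Delta_{\tilde{G}}$. These operators act on the space variable $x$ of functions of $(x,t)$. *)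

theory Defs
  imports Complex_Main "HOL-Algebra.Generated_Groups" "HOL-Algebra.Coset"
begin

definition virtually_abelian :: "('a, 'b) monoid_scheme \<Rightarrow> bool"
  where "virtually_abelian G \<longleftrightarrow>
    group G \<and>
    (\<exists>H. subgroup H G \<and> comm_group (G\<lparr>carrier := H\<rparr>) \<and> finite (rcosets\<^bsub>G\<^esub> H))"

definition symmetric_subset :: "('a, 'b) monoid_scheme \<Rightarrow> 'a set \<Rightarrow> bool"
  where "symmetric_subset G S \<longleftrightarrow> S \<subseteq> carrier G \<and> (\<forall>s\<in>S. inv\<^bsub>G\<^esub> s \<in> S)"

definition conjugation_invariant :: "('a, 'b) monoid_scheme \<Rightarrow> 'a set \<Rightarrow> bool"
  where "conjugation_invariant G S \<longleftrightarrow>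
    (\<forall>g\<in>carrier G. \<forall>s\<in>S. g \<otimes>\<^bsub>G\<^esub> s \<otimes>\<^bsub>G\<^esub> inv\<^bsub>G\<^esub> g \<in> S)"

text \<open>A graph is represented by its adjacency relation. The vertex set of the Cayley graph is the
  carrier of \<open>G\<close>, whatever subgroup \<open>S\<close> generates. If \<open>S\<close> contains the identity, there is a loop
  at every vertex; it contributes nothing to the Laplacian.\<close>

definition cayley_graph :: "('a, 'b) monoid_scheme \<Rightarrow> 'a set \<Rightarrow> 'a rel"
  where "cayley_graph G S = {(x, x \<otimes>\<^bsub>G\<^esub> s) |x s. x \<in> carrier G \<and> s \<in> S}"

text \<open>The sum is meaningful for locally finite graphs only.\<close>

definition laplacian :: "'a rel \<Rightarrow> ('a \<Rightarrow> real) \<Rightarrow> 'a \<Rightarrow> real"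
  where "laplacian E f x = (\<Sum>y\<in>E `` {x}. f y - f x)"

text \<open>The time derivative at \<open>t = 0\<close> is one-sided.\<close>

definition heat_solution :: "'a set \<Rightarrow> 'a rel \<Rightarrow> ('a \<Rightarrow> real \<Rightarrow> real) \<Rightarrow> bool"
  where "heat_solution V E w \<longleftrightarrow>
    (\<forall>x\<in>V. \<forall>t\<ge>0. (w x has_real_derivative laplacian E (\<lambda>y. w y t) x) (at t within {0..}))"

end

theory Submission imports Defs begin

text \<open>Since \<open>u \<ge> 1\<close>, \<open>-\<Delta>' log u\<close> is at most \<open>\<bar>\<Delta>' w\<bar>\<close> plus the squared gradient of \<open>w\<close> along \<open>S'\<close>,
  and by symmetry of \<open>S'\<close> the term \<open>\<Delta>' w\<close> is a sum of second differences. So it suffices that first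
  and second differences of bounded solutions along \<open>S'\<close> are \<open>O(t\<^sup>-\<^sup>1\<^sup>/\<^sup>2)\<close> and \<open>O(t\<^sup>-\<^sup>1)\<close>.
  The first bound is Bernstein's: the squared gradient \<open>\<Gamma>\<close> along \<open>S'\<close> is subcaloric by conjugation
  invariance, an averaged multiple \<open>P\<close> of \<open>w\<^sup>2\<close> has caloric defect at least \<open>\<Gamma>\<close>, and the maximum
  principle bounds \<open>t \<Gamma> + P\<close>. For the second bound, \<open>W (x,s) = w (x s) - w x\<close> solves the heat
  equation of the right action \<open>(x,s) \<mapsto> (x g, g\<^sup>-\<^sup>1 s g)\<close> on \<open>\<Phi> \<times> S'\<close>, and commutativity makes translation
  of \<open>x\<close> by \<open>r \<in> S'\<close> a composition of steps of this action, so the first bound applies to \<open>W\<close> on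
  \<open>[t/2,t]\<close>.\<close>

section \<open>Calculus of the heat equation with defect for a finite family of steps\<close>

locale step_system =
  fixes V :: "'x set" and I :: "'i set" and \<tau> :: "'i \<Rightarrow> 'x \<Rightarrow> 'x"
  assumes finite_steps: "finite I"
    and step_closed: "\<And>i x. i \<in> I \<Longrightarrow> x \<in> V \<Longrightarrow> \<tau> i x \<in> V"
begin

text \<open>The operator \<open>L f x = \<Sum>i. f (\<tau> i x) - f x\<close> plays the role of the Laplacian;
  \<open>r\<close> is the defect \<open>L w - \<partial>\<^sub>t w\<close>, so \<open>w\<close> is subcaloric when \<open>r \<ge> 0\<close>.\<close>

definition heat_defect :: "('x \<Rightarrow> real \<Rightarrow> real) \<Rightarrow> ('x \<Rightarrow> real \<Rightarrow> real) \<Rightarrow> bool"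
  where "heat_defect w r \<longleftrightarrow> (\<forall>x\<in>V. \<forall>t\<ge>0.
    (w x has_real_derivative (\<Sum>i\<in>I. w (\<tau> i x) t - w x t) - r x t) (at t within {0..}))"

lemma heat_defectD:
  assumes "heat_defect w r" "x \<in> V" "t \<ge> 0"
  shows "(w x has_real_derivative (\<Sum>i\<in>I. w (\<tau> i x) t - w x t) - r x t) (at t within {0..})"
  using assms unfolding heat_defect_def by blast

lemma heat_defect_zero: "heat_defect (\<lambda>x t. 0) (\<lambda>x t. 0)"
  unfolding heat_defect_def by simp

lemma heat_defect_add:
  assumes "heat_defect v p" "heat_defect w r"
  shows "heat_defect (\<lambda>x t. v x t + w x t) (\<lambda>x t. p x t + r x t)"
  unfolding heat_defect_def
proof (intro ballI allI impI)
  fix x and t :: real assume x: "x \<in> V" "t \<ge> 0"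
  show "((\<lambda>t. v x t + w x t) has_real_derivative
      (\<Sum>i\<in>I. v (\<tau> i x) t + w (\<tau> i x) t - (v x t + w x t)) - (p x t + r x t)) (at t within {0..})"
    by (rule derivative_eq_intros heat_defectD[OF assms(1) x] heat_defectD[OF assms(2) x] | simp)+
      (simp add: sum.distrib sum_subtractf algebra_simps)
qed

lemma heat_defect_cmult:
  assumes "heat_defect w r"
  shows "heat_defect (\<lambda>x t. c * w x t) (\<lambda>x t. c * r x t)"
  unfolding heat_defect_def
proof (intro ballI allI impI)
  fix x and t :: real assume x: "x \<in> V" "t \<ge> 0"
  show "((\<lambda>t. c * w x t) has_real_derivative
      (\<Sum>i\<in>I. c * w (\<tau> i x) t - c * w x t) - c * r x t) (at t within {0..})"
    by (rule derivative_eq_intros heat_defectD[OF assms x] | simp)+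
      (simp add: sum_distrib_left algebra_simps)
qed

lemma heat_defect_sum:
  assumes "\<And>j. j \<in> J \<Longrightarrow> heat_defect (w j) (r j)"
  shows "heat_defect (\<lambda>x t. \<Sum>j\<in>J. w j x t) (\<lambda>x t. \<Sum>j\<in>J. r j x t)"
  using assms
proof (induction J rule: infinite_finite_induct)
  case (insert j J)
  then show ?case using heat_defect_add[of "w j" "r j"] by simp
qed (simp_all add: heat_defect_zero)

text \<open>\<open>L\<close> is the sum over all steps minus \<open>card I\<close> times the
  identity, so it commutes with that sum even if single steps do not commute with each
  other.\<close>

lemma heat_defect_average:
  assumes "heat_defect w r"
  shows "heat_defect (\<lambda>x t. \<Sum>i\<in>I. w (\<tau> i x) t) (\<lambda>x t. \<Sum>i\<in>I. r (\<tau> i x) t)"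
  unfolding heat_defect_def
proof (intro ballI allI impI)
  fix x and t :: real assume x: "x \<in> V" "t \<ge> 0"
  have "((\<lambda>t. \<Sum>i\<in>I. w (\<tau> i x) t) has_real_derivative
      (\<Sum>i\<in>I. (\<Sum>j\<in>I. w (\<tau> j (\<tau> i x)) t - w (\<tau> i x) t) - r (\<tau> i x) t)) (at t within {0..})"
    by (rule DERIV_sum, rule heat_defectD[OF assms]) (auto simp: step_closed x)
  also have "(\<Sum>i\<in>I. (\<Sum>j\<in>I. w (\<tau> j (\<tau> i x)) t - w (\<tau> i x) t) - r (\<tau> i x) t)
    = (\<Sum>i\<in>I. (\<Sum>j\<in>I. w (\<tau> j (\<tau> i x)) t) - (\<Sum>j\<in>I. w (\<tau> j x) t)) - (\<Sum>i\<in>I. r (\<tau> i x) t)"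
    by (simp add: sum_subtractf sum_distrib_left)
  finally show "((\<lambda>t. \<Sum>i\<in>I. w (\<tau> i x) t) has_real_derivative
      (\<Sum>i\<in>I. (\<Sum>j\<in>I. w (\<tau> j (\<tau> i x)) t) - (\<Sum>j\<in>I. w (\<tau> j x) t)) - (\<Sum>i\<in>I. r (\<tau> i x) t))
      (at t within {0..})" .
qed

text \<open>The product rule costs the term \<open>- w\<close>; in Bernstein's argument the defect
  of the potential pays for it.\<close>

lemma heat_defect_times_t:
  assumes "heat_defect w r"
  shows "heat_defect (\<lambda>x t. t * w x t) (\<lambda>x t. t * r x t - w x t)"
  unfolding heat_defect_def
proof (intro ballI allI impI)
  fix x and t :: real assume x: "x \<in> V" "t \<ge> 0"
  show "((\<lambda>t. t * w x t) has_real_derivative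
      (\<Sum>i\<in>I. t * w (\<tau> i x) t - t * w x t) - (t * r x t - w x t)) (at t within {0..})"
    by (rule derivative_eq_intros heat_defectD[OF assms x] | simp)+
      (simp add: sum_subtractf algebra_simps flip: sum_distrib_left)
qed

text \<open>Restarts the equation at time \<open>a\<close>; the bound on second differences takes
  \<open>a = t / 2\<close>.\<close>

lemma heat_defect_shift:
  assumes "heat_defect w r" "a \<ge> 0"
  shows "heat_defect (\<lambda>x t. w x (t + a)) (\<lambda>x t. r x (t + a))"
  unfolding heat_defect_def
proof (intro ballI allI impI)
  fix x and t :: real assume x: "x \<in> V" "t \<ge> 0"
  have "(w x has_real_derivative (\<Sum>i\<in>I. w (\<tau> i x) (t + a) - w x (t + a)) - r x (t + a))
      (at (t + a) within (\<lambda>t. t + a) ` {0..})"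
    by (rule has_field_derivative_subset[OF heat_defectD[OF assms(1)]]) (use x assms(2) in auto)
  moreover have "((\<lambda>t. t + a) has_real_derivative 1) (at t within {0..})"
    by (auto intro!: derivative_eq_intros)
  ultimately show "((\<lambda>t. w x (t + a)) has_real_derivative
      (\<Sum>i\<in>I. w (\<tau> i x) (t + a) - w x (t + a)) - r x (t + a)) (at t within {0..})"
    using DERIV_image_chain[of "w x" _ "\<lambda>t. t + a" t "{0..}" 1] by (simp add: o_def)
qed

text \<open>Sum \<open>b^2 - a^2 - 2 a (b - a) = (b - a)^2\<close> over the steps, with
  \<open>a\<close> the value at \<open>x\<close> and \<open>b\<close> the value after the
  step.\<close>

lemma heat_defect_square:
  assumes "heat_defect w (\<lambda>x t. 0)"
  shows "heat_defect (\<lambda>x t. (w x t)\<^sup>2) (\<lambda>x t. \<Sum>i\<in>I. (w (\<tau> i x) t - w x t)\<^sup>2)"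
  unfolding heat_defect_def
proof (intro ballI allI impI)
  fix x and t :: real assume x: "x \<in> V" "t \<ge> 0"
  show "((\<lambda>t. (w x t)\<^sup>2) has_real_derivative
      (\<Sum>i\<in>I. (w (\<tau> i x) t)\<^sup>2 - (w x t)\<^sup>2) - (\<Sum>i\<in>I. (w (\<tau> i x) t - w x t)\<^sup>2)) (at t within {0..})"
    by (rule derivative_eq_intros heat_defectD[OF assms x] | simp)+
      (simp add: sum_distrib_left sum_distrib_right flip: sum_subtractf,
       intro sum.cong refl, simp add: power2_eq_square algebra_simps)
qed

section \<open>Maximum principle on a possibly infinite vertex set\<close>

text \<open>No maximum need be attained on an infinite \<open>V\<close>. Since \<open>L\<close> is bounded, the supremum \<open>B\<close> of
  the excess over \<open>K\<close> on \<open>V \<times> [0,T]\<close> improves itself to \<open>B (1 - e\<^bsup>-dT\<^esup>)\<close> with \<open>d = card I\<close>.\<close>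

lemma maximum_principle:
  assumes heat: "heat_defect H r"
    and r: "\<And>x t. x \<in> V \<Longrightarrow> t \<ge> 0 \<Longrightarrow> r x t \<ge> 0"
    and init: "\<And>x. x \<in> V \<Longrightarrow> H x 0 \<le> K"
    and bdd: "\<And>x t. x \<in> V \<Longrightarrow> 0 \<le> t \<Longrightarrow> t \<le> T \<Longrightarrow> H x t \<le> M"
    and x: "x \<in> V" and T: "0 \<le> T"
  shows "H x T \<le> K"
proof -
  define d where "d = real (card I)"
  \<comment> \<open>The inserted 0 forces \<open>B\<close> to be nonnegative.\<close>
  define X where "X = insert 0 {H y t - K | y t. y \<in> V \<and> 0 \<le> t \<and> t \<le> T}"
  define B where "B = Sup X"
  have bX: "bdd_above X"
    unfolding X_def using bdd by (auto intro!: bdd_aboveI[of _ "M - K"] simp: bdd_above_insert)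
  have B: "H y t - K \<le> B" if "y \<in> V" "0 \<le> t" "t \<le> T" for y t
    unfolding B_def by (rule cSup_upper[OF _ bX]) (use that in \<open>auto simp: X_def\<close>)
  have B0: "0 \<le> B" unfolding B_def by (rule cSup_upper[OF _ bX]) (simp add: X_def)
  have improve: "H y t - K \<le> B * (1 - exp (- d * T))" if yt: "y \<in> V" "0 \<le> t" "t \<le> T" for y t
  proof -
    \<comment> \<open>The integrating factor absorbs the diagonal term \<open>- d * H\<close> of
      \<open>L\<close>. What remains is a sum of values of \<open>H - K - B\<close>, nonpositive by
      the choice of \<open>B\<close>, minus the defect.\<close>
    define g where "g = (\<lambda>s. exp (d * s) * (H y s - K - B))"
    define g' where "g' = (\<lambda>s. exp (d * s) * ((\<Sum>i\<in>I. H (\<tau> i y) s - K - B) - r y s))"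
    have der: "(g has_real_derivative g' s) (at s within {0..})" if "0 \<le> s" for s
      unfolding g_def g'_def
      by (rule derivative_eq_intros heat_defectD[OF heat yt(1) that] | simp)+
        (simp add: algebra_simps sum_subtractf d_def)
    have nonpos: "g' s \<le> 0" if "0 \<le> s" "s \<le> t" for s
    proof -
      have "(\<Sum>i\<in>I. H (\<tau> i y) s - K - B) \<le> 0"
        by (rule sum_nonpos) (use B[of "\<tau> _ y" s] step_closed yt that in force)
      then show ?thesis
        using r[OF yt(1) that(1)] by (simp add: g'_def mult_le_0_iff)
    qed
    have "g t \<le> g 0"
    proof (cases "t = 0")
      case False
      show ?thesis
      proof (rule DERIV_nonpos_imp_decreasing_open[where f = g])
        show "0 \<le> t" by fact
        show "\<exists>z. DERIV g s :> z \<and> z \<le> 0" if "0 < s" "s < t" for s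
        proof -
          have "at s within {0..} = at s"
            by (rule at_within_nhd[where S = "{0<..}"]) (use that in auto)
          then show ?thesis using der[of s] nonpos[of s] that by auto
        qed
        have "continuous_on {0..} g"
          using der by (intro DERIV_continuous_on) auto
        then show "continuous_on {0..t} g" by (rule continuous_on_subset) auto
      qed
    qed simp
    also have "g 0 \<le> - B" using init[OF yt(1)] by (simp add: g_def)
    finally have "exp (- d * t) * (exp (d * t) * (H y t - K - B)) \<le> exp (- d * t) * (- B)"
      unfolding g_def by (intro mult_left_mono) auto
    then have "H y t - K - B \<le> - exp (- d * t) * B"
      by (simp add: exp_minus flip: mult.assoc)
    \<comment> \<open>Passing from \<open>t\<close> to \<open>T\<close> makes the improved bound
      uniform in time, so that it carries over to the supremum \<open>B\<close>.\<close>
    moreover have "exp (- d * T) * B \<le> exp (- d * t) * B"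
      using yt B0 by (intro mult_right_mono) (auto simp: d_def mult_left_mono)
    ultimately show ?thesis by (simp add: algebra_simps)
  qed
  have "0 \<le> B * (1 - exp (- d * T))" using B0 T by (simp add: d_def)
  then have "B \<le> B * (1 - exp (- d * T))"
    using improve by (subst (1) B_def, intro cSup_least) (auto simp: X_def)
  then have "B * exp (- d * T) \<le> 0" by (simp add: algebra_simps)
  then have "B \<le> 0" by (simp add: mult_le_0_iff)
  with B[OF x T] show ?thesis by simp
qed

section \<open>A potential whose defect controls increments along words\<close>

text \<open>With \<open>A f x\<close> the sum of \<open>f\<close> over all steps from
  \<open>x\<close>, this is the sum of \<open>2^(j+1) A^j (w^2)\<close> over \<open>j < n\<close>.
  The factors 2 are those of \<open>(a + b)^2 \<le> 2 a^2 + 2 b^2\<close>, used once for each letter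
  of a word.\<close>

fun potential :: "('x \<Rightarrow> real \<Rightarrow> real) \<Rightarrow> nat \<Rightarrow> 'x \<Rightarrow> real \<Rightarrow> real" where
  "potential w 0 x t = 0"
| "potential w (Suc n) x t = 2 * (\<Sum>i\<in>I. potential w n (\<tau> i x) t) + 2 * (w x t)\<^sup>2"

fun potential_defect :: "('x \<Rightarrow> real \<Rightarrow> real) \<Rightarrow> nat \<Rightarrow> 'x \<Rightarrow> real \<Rightarrow> real" where
  "potential_defect w 0 x t = 0"
| "potential_defect w (Suc n) x t =
    2 * (\<Sum>i\<in>I. potential_defect w n (\<tau> i x) t) + 2 * (\<Sum>i\<in>I. (w (\<tau> i x) t - w x t)\<^sup>2)"

fun potential_bound :: "nat \<Rightarrow> real" where
  "potential_bound 0 = 0"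
| "potential_bound (Suc n) = 2 * card I * potential_bound n + 2"

lemma heat_defect_potential:
  assumes "heat_defect w (\<lambda>x t. 0)"
  shows "heat_defect (potential w n) (potential_defect w n)"
proof (induction n)
  case 0
  then show ?case using heat_defect_zero by (simp add: heat_defect_def)
next
  case (Suc n)
  have "heat_defect
    (\<lambda>x t. 2 * (\<Sum>i\<in>I. potential w n (\<tau> i x) t) + 2 * (w x t)\<^sup>2)
    (\<lambda>x t. 2 * (\<Sum>i\<in>I. potential_defect w n (\<tau> i x) t) + 2 * (\<Sum>i\<in>I. (w (\<tau> i x) t - w x t)\<^sup>2))"
    by (intro heat_defect_add heat_defect_cmult heat_defect_average Suc heat_defect_square assms)
  then show ?case by (simp add: heat_defect_def)
qed

lemma potential_nonneg: "0 \<le> potential w n x t"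
  by (induction n arbitrary: x) (auto intro!: add_nonneg_nonneg sum_nonneg)

lemma potential_defect_nonneg: "0 \<le> potential_defect w n x t"
  by (induction n arbitrary: x) (auto intro!: add_nonneg_nonneg sum_nonneg)

lemma potential_bound_nonneg: "0 \<le> potential_bound n"
  by (induction n) auto

lemma potential_le:
  assumes "\<And>x. x \<in> V \<Longrightarrow> \<bar>w x t\<bar> \<le> B" "x \<in> V"
  shows "potential w n x t \<le> potential_bound n * B\<^sup>2"
  using assms(2)
proof (induction n arbitrary: x)
  case (Suc n)
  have "(\<Sum>i\<in>I. potential w n (\<tau> i x) t) \<le> card I * (potential_bound n * B\<^sup>2)"
    by (rule sum_bounded_above) (use Suc step_closed in auto)
  moreover have "(w x t)\<^sup>2 \<le> B\<^sup>2"
    using assms(1)[OF Suc.prems] by (metis abs_ge_zero power2_abs power_mono)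
  ultimately show ?case by (simp add: algebra_simps)
qed simp

text \<open>\<open>fold\<close> performs the head step first, so the increment splits into that of
  this step and that of the tail started at \<open>\<tau> i x\<close>. Each square is then one term
  of a nonnegative sum over \<open>I\<close>.\<close>

lemma increment_le_potential_defect:
  assumes "set ws \<subseteq> I"
  shows "(w (fold \<tau> ws x) t - w x t)\<^sup>2 \<le> potential_defect w (length ws) x t"
  using assms
proof (induction ws arbitrary: x)
  case (Cons i ws)
  let ?a = "w (fold \<tau> ws (\<tau> i x)) t - w (\<tau> i x) t" and ?b = "w (\<tau> i x) t - w x t"
  have i: "i \<in> I" using Cons.prems by simp
  have "(?a + ?b)\<^sup>2 \<le> 2 * ?a\<^sup>2 + 2 * ?b\<^sup>2"
    using zero_le_power2[of "?a - ?b"] by (simp add: power2_eq_square algebra_simps)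
  moreover have "?a\<^sup>2 \<le> potential_defect w (length ws) (\<tau> i x) t" using Cons by auto
  moreover have "\<dots> \<le> (\<Sum>i\<in>I. potential_defect w (length ws) (\<tau> i x) t)"
    by (rule member_le_sum[OF i _ finite_steps]) (simp add: potential_defect_nonneg)
  moreover have "?b\<^sup>2 \<le> (\<Sum>i\<in>I. (w (\<tau> i x) t - w x t)\<^sup>2)"
    by (rule member_le_sum[OF i _ finite_steps]) simp
  ultimately show ?case by simp
qed simp

end

section \<open>Bernstein's gradient estimate\<close>

text \<open>The family \<open>\<sigma>\<close> commutes with the steps only up to a permutation; summing over it makes the
  squared gradient subcaloric all the same.\<close>

locale permuted_translations = step_system V I \<tau>
  for V :: "'x set" and I :: "'i set" and \<tau> :: "'i \<Rightarrow> 'x \<Rightarrow> 'x" +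
  fixes R :: "'r set" and \<sigma> :: "'r \<Rightarrow> 'x \<Rightarrow> 'x" and \<pi> :: "'i \<Rightarrow> 'r \<Rightarrow> 'r" and wd :: "'r \<Rightarrow> 'i list"
  assumes finite_translations: "finite R"
    and word: "\<And>r. r \<in> R \<Longrightarrow> set (wd r) \<subseteq> I"
    and fold_word: "\<And>r x. r \<in> R \<Longrightarrow> x \<in> V \<Longrightarrow> fold \<tau> (wd r) x = \<sigma> r x"
    and permutes: "\<And>i. i \<in> I \<Longrightarrow> bij_betw (\<pi> i) R R"
    and commute: "\<And>i r x. i \<in> I \<Longrightarrow> r \<in> R \<Longrightarrow> x \<in> V \<Longrightarrow> \<sigma> r (\<tau> i x) = \<tau> i (\<sigma> (\<pi> i r) x)"
begin

lemma fold_closed: "set ws \<subseteq> I \<Longrightarrow> x \<in> V \<Longrightarrow> fold \<tau> ws x \<in> V"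
  by (induction ws arbitrary: x) (auto simp: step_closed)

lemma translation_closed: "r \<in> R \<Longrightarrow> x \<in> V \<Longrightarrow> \<sigma> r x \<in> V"
  using fold_closed[OF word] fold_word by metis

text \<open>Reindexing by \<open>\<pi> i\<close> turns the increments based at
  \<open>\<tau> i x\<close> into the differences \<open>D' i r\<close>. By
  \<open>b^2 - a^2 - (b - a)^2 = 2 a (b - a)\<close>, subtracting the defect leaves exactly the time
  derivative of the squares.\<close>

lemma heat_defect_gradient_square:
  assumes "heat_defect w (\<lambda>x t. 0)"
  shows "heat_defect (\<lambda>x t. \<Sum>r\<in>R. (w (\<sigma> r x) t - w x t)\<^sup>2)
    (\<lambda>x t. \<Sum>r\<in>R. \<Sum>i\<in>I. (w (\<tau> i (\<sigma> r x)) t - w (\<tau> i x) t - (w (\<sigma> r x) t - w x t))\<^sup>2)"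
  unfolding heat_defect_def
proof (intro ballI allI impI)
  fix x and t :: real assume x: "x \<in> V" "t \<ge> 0"
  define D where "D r = w (\<sigma> r x) t - w x t" for r
  define D' where "D' i r = w (\<tau> i (\<sigma> r x)) t - w (\<tau> i x) t" for i r
  have "(\<Sum>r\<in>R. (w (\<sigma> r (\<tau> i x)) t - w (\<tau> i x) t)\<^sup>2) = (\<Sum>r\<in>R. (D' i r)\<^sup>2)" if i: "i \<in> I" for i
  proof -
    have "(\<Sum>r\<in>R. (w (\<sigma> r (\<tau> i x)) t - w (\<tau> i x) t)\<^sup>2) = (\<Sum>r\<in>R. (D' i (\<pi> i r))\<^sup>2)"
      unfolding D'_def by (rule sum.cong) (auto simp: commute i x)
    also have "\<dots> = (\<Sum>r\<in>R. (D' i r)\<^sup>2)" by (rule sum.reindex_bij_betw[OF permutes[OF i]])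
    finally show ?thesis .
  qed
  then have "(\<Sum>i\<in>I. (\<Sum>r\<in>R. (w (\<sigma> r (\<tau> i x)) t - w (\<tau> i x) t)\<^sup>2) - (\<Sum>r\<in>R. (D r)\<^sup>2))
      = (\<Sum>i\<in>I. \<Sum>r\<in>R. (D' i r)\<^sup>2 - (D r)\<^sup>2)"
    by (simp add: sum_subtractf)
  also have "\<dots> = (\<Sum>r\<in>R. \<Sum>i\<in>I. (D' i r)\<^sup>2 - (D r)\<^sup>2)" by (rule sum.swap)
  also have "\<dots> - (\<Sum>r\<in>R. \<Sum>i\<in>I. (D' i r - D r)\<^sup>2)
      = (\<Sum>r\<in>R. 2 * D r * (\<Sum>i\<in>I. D' i r - D r))"
    by (simp add: sum_distrib_left flip: sum_subtractf)
      (intro sum.cong refl, simp add: power2_eq_square algebra_simps)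
  finally have eq: "(\<Sum>i\<in>I. (\<Sum>r\<in>R. (w (\<sigma> r (\<tau> i x)) t - w (\<tau> i x) t)\<^sup>2) - (\<Sum>r\<in>R. (D r)\<^sup>2))
      - (\<Sum>r\<in>R. \<Sum>i\<in>I. (D' i r - D r)\<^sup>2) = (\<Sum>r\<in>R. 2 * D r * (\<Sum>i\<in>I. D' i r - D r))" .
  have "((\<lambda>t. \<Sum>r\<in>R. (w (\<sigma> r x) t - w x t)\<^sup>2) has_real_derivative
      (\<Sum>r\<in>R. 2 * D r * (\<Sum>i\<in>I. D' i r - D r))) (at t within {0..})"
  proof (rule DERIV_sum)
    fix r assume r: "r \<in> R"
    have deriv_eq: "(\<Sum>i\<in>I. D' i r - D r) = (\<Sum>i\<in>I. w (\<tau> i (\<sigma> r x)) t - w (\<sigma> r x) t)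
        - (\<Sum>i\<in>I. w (\<tau> i x) t - w x t)"
      by (simp add: D_def D'_def sum_subtractf right_diff_distrib)
    note der = heat_defectD[OF assms translation_closed[OF r x(1)] x(2)] heat_defectD[OF assms x]
    show "((\<lambda>t. (w (\<sigma> r x) t - w x t)\<^sup>2) has_real_derivative
        2 * D r * (\<Sum>i\<in>I. D' i r - D r)) (at t within {0..})"
      unfolding deriv_eq by (rule derivative_eq_intros der | simp)+ (simp add: D_def)
  qed
  then show "((\<lambda>t. \<Sum>r\<in>R. (w (\<sigma> r x) t - w x t)\<^sup>2) has_real_derivative
     (\<Sum>i\<in>I. (\<Sum>r\<in>R. (w (\<sigma> r (\<tau> i x)) t - w (\<tau> i x) t)\<^sup>2) - (\<Sum>r\<in>R. (w (\<sigma> r x) t - w x t)\<^sup>2)) -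
     (\<Sum>r\<in>R. \<Sum>i\<in>I. (w (\<tau> i (\<sigma> r x)) t - w (\<tau> i x) t - (w (\<sigma> r x) t - w x t))\<^sup>2)) (at t within {0..})"
    by (simp only: eq[unfolded D_def D'_def] D_def D'_def)
qed

text \<open>Built from word lengths and the number of steps alone, never from a solution; hence the
  final constant is uniform in \<open>w\<close>.\<close>

definition gradient_const :: real
  where "gradient_const = sqrt (\<Sum>r\<in>R. potential_bound (length (wd r)))"

lemma gradient_const_nonneg: "0 \<le> gradient_const"
  unfolding gradient_const_def by (simp add: sum_nonneg potential_bound_nonneg)

theorem gradient_estimate:
  assumes heat: "heat_defect w (\<lambda>x t. 0)"
    and bound: "\<And>x t. x \<in> V \<Longrightarrow> t \<ge> 0 \<Longrightarrow> \<bar>w x t\<bar> \<le> B"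
    and r: "r \<in> R" and x: "x \<in> V" and t: "t > 0"
  shows "\<bar>w (\<sigma> r x) t - w x t\<bar> \<le> gradient_const * B / sqrt t"
proof -
  define Q where "Q x t = (\<Sum>r\<in>R. (w (\<sigma> r x) t - w x t)\<^sup>2)" for x t
  define P where "P x t = (\<Sum>r\<in>R. potential w (length (wd r)) x t)" for x t
  define K where "K = gradient_const\<^sup>2 * B\<^sup>2"
  define q where "q x t = (\<Sum>r\<in>R. \<Sum>i\<in>I.
    (w (\<tau> i (\<sigma> r x)) t - w (\<tau> i x) t - (w (\<sigma> r x) t - w x t))\<^sup>2)" for x t
  define p where "p x t = (\<Sum>r\<in>R. potential_defect w (length (wd r)) x t)" for x t
  have "heat_defect Q q"
    unfolding Q_def[abs_def] q_def[abs_def] by (rule heat_defect_gradient_square[OF heat])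
  moreover have "heat_defect P p"
    unfolding P_def[abs_def] p_def[abs_def]
    by (intro heat_defect_sum heat_defect_potential heat)
  ultimately have H: "heat_defect (\<lambda>x t. t * Q x t + P x t) (\<lambda>x t. t * q x t - Q x t + p x t)"
    by (intro heat_defect_add heat_defect_times_t)
  \<comment> \<open>This covers the loss \<open>- Q\<close> in the defect: \<open>\<sigma> r\<close>
    is the word \<open>wd r\<close>, whose squared increment is dominated by the matching summand of
    \<open>p\<close>.\<close>
  have Qp: "Q x t \<le> p x t" if "x \<in> V" for x t
    unfolding Q_def p_def using increment_le_potential_defect[OF word] fold_word that
    by (intro sum_mono) metis
  have B0: "0 \<le> B" using bound[OF x, of 0] by simp
  have P_le: "P x t \<le> K" if "x \<in> V" "t \<ge> 0" for x t
    unfolding P_def K_def gradient_const_def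
    by (auto simp: sum_nonneg potential_bound_nonneg sum_distrib_right that bound intro!: sum_mono potential_le)
  have Q_le: "Q x t \<le> card R * (2 * B)\<^sup>2" if "x \<in> V" "t \<ge> 0" for x t
    unfolding Q_def
  proof (rule sum_bounded_above)
    fix r assume "r \<in> R"
    then have "\<bar>w (\<sigma> r x) t - w x t\<bar> \<le> 2 * B"
      using bound[of x t] bound[of "\<sigma> r x" t] translation_closed[of r x] that by linarith
    then show "(w (\<sigma> r x) t - w x t)\<^sup>2 \<le> (2 * B)\<^sup>2"
      by (metis abs_ge_zero power2_abs power_mono)
  qed
  have "t * Q x t + P x t \<le> K"
  proof (rule maximum_principle[OF H])
    show "0 \<le> t * q x t - Q x t + p x t" if "x \<in> V" "t \<ge> 0" for x t
    proof -
      have "0 \<le> q x t" unfolding q_def by (intro sum_nonneg) auto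
      then show ?thesis using Qp[OF that(1), of t] that(2) by (smt (verit) mult_nonneg_nonneg)
    qed
    show "0 * Q x 0 + P x 0 \<le> K" if "x \<in> V" for x using P_le that by simp
    \<comment> \<open>A crude bound on \<open>[0,t]\<close> suffices for the maximum principle; its
      size does not enter \<open>K\<close>.\<close>
    show "s * Q y s + P y s \<le> t * (card R * (2 * B)\<^sup>2) + K" if "y \<in> V" "0 \<le> s" "s \<le> t" for y s
    proof -
      have "s * Q y s \<le> t * (card R * (2 * B)\<^sup>2)"
        using Q_le[OF that(1,2)] that t by (intro mult_mono) (auto simp: Q_def sum_nonneg)
      with P_le[OF that(1,2)] show ?thesis by simp
    qed
  qed (use x t in auto)
  moreover have "0 \<le> P x t" unfolding P_def by (simp add: sum_nonneg potential_nonneg)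
  moreover have "(w (\<sigma> r x) t - w x t)\<^sup>2 \<le> Q x t"
    unfolding Q_def by (rule member_le_sum[OF r _ finite_translations]) simp
  ultimately have "t * (w (\<sigma> r x) t - w x t)\<^sup>2 \<le> K"
    using t by (smt (verit) mult_left_mono)
  then have "(w (\<sigma> r x) t - w x t)\<^sup>2 \<le> (gradient_const * B / sqrt t)\<^sup>2"
    using t by (simp add: K_def field_simps power_mult_distrib power_divide)
  then show ?thesis
    using abs_le_square_iff[of "w (\<sigma> r x) t - w x t" "gradient_const * B / sqrt t"]
      gradient_const_nonneg B0 t by simp
qed

end

section \<open>Words in the generators and the Laplacian of a Cayley graph\<close>

text \<open>One word has to serve all \<open>(x, s)\<close>. Products become concatenations, because
  \<open>fold\<close> runs the left word first, and symmetry of \<open>S\<close> makes inverses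
  single letters.\<close>

lemma (in group) generate_as_product:
  assumes S: "S \<subseteq> carrier G" "\<And>s. s \<in> S \<Longrightarrow> inv s \<in> S" and h: "h \<in> generate G S"
  shows "\<exists>ws. set ws \<subseteq> S \<and> (\<forall>x\<in>carrier G. \<forall>s\<in>carrier G.
    fold (\<lambda>g (x, s). (x \<otimes> g, inv g \<otimes> s \<otimes> g)) ws (x, s) = (x \<otimes> h, inv h \<otimes> s \<otimes> h))"
  using h
proof (induction h rule: generate.induct)
  case one
  then show ?case by (intro exI[of _ "[]"]) auto
next
  case (incl h)
  then show ?case by (intro exI[of _ "[h]"]) auto
next
  case (inv h)
  then show ?case using S by (intro exI[of _ "[inv h]"]) auto
next
  case (eng h1 h2)
  then obtain ws1 ws2 where ws: "set ws1 \<subseteq> S" "set ws2 \<subseteq> S"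
    "\<forall>x\<in>carrier G. \<forall>s\<in>carrier G.
      fold (\<lambda>g (x, s). (x \<otimes> g, inv g \<otimes> s \<otimes> g)) ws1 (x, s) = (x \<otimes> h1, inv h1 \<otimes> s \<otimes> h1)"
    "\<forall>x\<in>carrier G. \<forall>s\<in>carrier G.
      fold (\<lambda>g (x, s). (x \<otimes> g, inv g \<otimes> s \<otimes> g)) ws2 (x, s) = (x \<otimes> h2, inv h2 \<otimes> s \<otimes> h2)"
    by blast
  have "h1 \<in> carrier G" "h2 \<in> carrier G"
    using eng generate_in_carrier[OF S(1)] by auto
  then show ?case
    using ws by (intro exI[of _ "ws1 @ ws2"]) (auto simp: m_assoc inv_mult_group)
qed

text \<open>By left cancellation distinct generators lead to distinct neighbours.\<close>

lemma (in group) laplacian_cayley_graph: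
  assumes "S \<subseteq> carrier G" "x \<in> carrier G"
  shows "laplacian (cayley_graph G S) f x = (\<Sum>s\<in>S. f (x \<otimes> s) - f x)"
proof -
  have "cayley_graph G S `` {x} = (\<lambda>s. x \<otimes> s) ` S"
    using assms(2) unfolding cayley_graph_def by auto
  moreover have "inj_on (\<lambda>s. x \<otimes> s) S"
    using assms by (auto simp: inj_on_def subset_iff)
  ultimately show ?thesis
    unfolding laplacian_def by (simp add: sum.reindex)
qed

text \<open>Only the lower bound 1 on the arguments matters; this is where \<open>\<surd>k\<close> enters.\<close>

lemma ln_diff_le:
  fixes a b :: real
  assumes "1 \<le> a" "1 \<le> b"
  shows "ln a - ln b \<le> (a - b) / a + (b - a)\<^sup>2"
proof -
  have "ln (a / b) \<le> a / b - 1" using assms by (intro ln_le_minus_one) simp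
  then have "ln a - ln b \<le> a / b - 1" using assms by (simp add: ln_div)
  \<comment> \<open>The linear term gets denominator \<open>a\<close> instead of \<open>b\<close>:
    \<open>a\<close> will be the value at the centre, common to all neighbours, so that these terms
    add up to a Laplacian.\<close>
  also have "\<dots> = (a - b) / a + (b - a)\<^sup>2 / (a * b)"
    using assms by (simp add: field_simps power2_eq_square)
  also have "(b - a)\<^sup>2 / (a * b) \<le> (b - a)\<^sup>2"
    using assms mult_mono[of 1 a 1 b] by (simp add: divide_le_eq mult_le_cancel_left1)
  finally show ?thesis by simp
qed

section \<open>First and second differences along \<open>S'\<close>, and the logarithmic
  bound\<close>

theorem theorem1p7:
  fixes \<Phi> :: "('a, 'b) monoid_scheme"
    and \<Phi>' S S' :: "'a set"
    and k :: nat
  assumes "virtually_abelian \<Phi>"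
    and "\<Phi>' \<lhd> \<Phi>"
    and "comm_group (\<Phi>\<lparr>carrier := \<Phi>'\<rparr>)"
    and "finite (rcosets\<^bsub>\<Phi>\<^esub> \<Phi>')"
    and "card (rcosets\<^bsub>\<Phi>\<^esub> \<Phi>') = k"
    and "finite S"
    and "symmetric_subset \<Phi> S"
    and "generate \<Phi> S = carrier \<Phi>"
    and "finite S'"
    and "S' \<subseteq> \<Phi>'"
    and "symmetric_subset \<Phi> S'"
    and "generate \<Phi> S' = \<Phi>'"
    and "conjugation_invariant \<Phi> S'"
  shows "\<exists>C>0. \<forall>w :: 'a \<Rightarrow> real \<Rightarrow> real.
    heat_solution (carrier \<Phi>) (cayley_graph \<Phi> S) w \<longrightarrow>
    (\<forall>x\<in>carrier \<Phi>. \<forall>t\<ge>0. w x t \<in> {0..1}) \<longrightarrow>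
    (\<forall>x\<in>carrier \<Phi>. \<forall>t>0.
      - laplacian (cayley_graph \<Phi> S') (\<lambda>y. ln (w y t + sqrt (real k))) x \<le> C / t)"
proof -
  interpret normal \<Phi>' \<Phi> by fact
  have S: "S \<subseteq> carrier \<Phi>" "\<And>s. s \<in> S \<Longrightarrow> inv\<^bsub>\<Phi>\<^esub> s \<in> S"
    using assms(7) by (auto simp: symmetric_subset_def)
  have S': "S' \<subseteq> carrier \<Phi>" "\<And>s. s \<in> S' \<Longrightarrow> inv\<^bsub>\<Phi>\<^esub> s \<in> S'"
    using assms(11) by (auto simp: symmetric_subset_def)
  have S'c: "s \<in> carrier \<Phi>" if "s \<in> S'" for s using S' that by auto
  have Sc: "s \<in> carrier \<Phi>" if "s \<in> S" for s using S that by auto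
  have conj: "g \<otimes>\<^bsub>\<Phi>\<^esub> s \<otimes>\<^bsub>\<Phi>\<^esub> inv\<^bsub>\<Phi>\<^esub> g \<in> S'" if "g \<in> carrier \<Phi>" "s \<in> S'" for g s
    using assms(13) that by (auto simp: conjugation_invariant_def)
  have conj': "inv\<^bsub>\<Phi>\<^esub> g \<otimes>\<^bsub>\<Phi>\<^esub> s \<otimes>\<^bsub>\<Phi>\<^esub> g \<in> S'" if "g \<in> carrier \<Phi>" "s \<in> S'" for g s
    using conj[of "inv\<^bsub>\<Phi>\<^esub> g" s] that by simp
  have comm: "r \<otimes>\<^bsub>\<Phi>\<^esub> s = s \<otimes>\<^bsub>\<Phi>\<^esub> r" if "r \<in> S'" "s \<in> S'" for r s
    using comm_groupE(4)[OF assms(3), of r s] that assms(10) by auto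
  have cancel: "g \<otimes>\<^bsub>\<Phi>\<^esub> (inv\<^bsub>\<Phi>\<^esub> g \<otimes>\<^bsub>\<Phi>\<^esub> s) = s" "inv\<^bsub>\<Phi>\<^esub> g \<otimes>\<^bsub>\<Phi>\<^esub> (g \<otimes>\<^bsub>\<Phi>\<^esub> s) = s"
    if "g \<in> carrier \<Phi>" "s \<in> carrier \<Phi>" for g s
    using that by (simp_all flip: m_assoc)
  have k: "1 \<le> k"
    using subgroup_in_rcosets[OF is_group] assms(4,5) by (metis One_nat_def Suc_leI card_gt_0_iff empty_iff)
  \<comment> \<open>Conjugating \<open>s\<close> makes the product of the two coordinates move by
    \<open>g\<close> as well: \<open>(x g) (g^-1 s g) = (x s) g\<close>. This is what makes
    \<open>w (x s) - w x\<close> a solution in \<open>heat2\<close>.\<close>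
  define act where "act = (\<lambda>g (x, s). (x \<otimes>\<^bsub>\<Phi>\<^esub> g, inv\<^bsub>\<Phi>\<^esub> g \<otimes>\<^bsub>\<Phi>\<^esub> s \<otimes>\<^bsub>\<Phi>\<^esub> g))"
  have "\<exists>ws. set ws \<subseteq> S \<and> (\<forall>x\<in>carrier \<Phi>. \<forall>s\<in>S'. fold act ws (x, s) = (x \<otimes>\<^bsub>\<Phi>\<^esub> r, s))" if r: "r \<in> S'" for r
  proof -
    have rc: "r \<in> generate \<Phi> S" using S'c[OF r] assms(8) by simp
    obtain ws where ws: "set ws \<subseteq> S" "\<forall>x\<in>carrier \<Phi>. \<forall>s\<in>carrier \<Phi>.
        fold act ws (x, s) = (x \<otimes>\<^bsub>\<Phi>\<^esub> r, inv\<^bsub>\<Phi>\<^esub> r \<otimes>\<^bsub>\<Phi>\<^esub> s \<otimes>\<^bsub>\<Phi>\<^esub> r)"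
      using generate_as_product[OF S rc] unfolding act_def by blast
    have "inv\<^bsub>\<Phi>\<^esub> r \<otimes>\<^bsub>\<Phi>\<^esub> s \<otimes>\<^bsub>\<Phi>\<^esub> r = s" if "s \<in> S'" for s
      using comm[OF r that] S'c[OF r] S'c[OF that] by (metis inv_closed inv_solve_left m_assoc m_closed)
    then show ?thesis using ws S'c by (intro exI[of _ ws]) auto
  qed
  then obtain wd where wd: "\<And>r. r \<in> S' \<Longrightarrow> set (wd r) \<subseteq> S"
    "\<And>r x s. r \<in> S' \<Longrightarrow> x \<in> carrier \<Phi> \<Longrightarrow> s \<in> S' \<Longrightarrow> fold act (wd r) (x, s) = (x \<otimes>\<^bsub>\<Phi>\<^esub> r, s)"
    by metis
  define \<sigma> where "\<sigma> = (\<lambda>r (x, s :: 'a). (x \<otimes>\<^bsub>\<Phi>\<^esub> r, s))"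
  \<comment> \<open>The permutation is conjugation, since
    \<open>x g r = x (g r g^-1) g\<close>.\<close>
  interpret T: permuted_translations "carrier \<Phi> \<times> S'" S act S' \<sigma>
    "\<lambda>g r. g \<otimes>\<^bsub>\<Phi>\<^esub> r \<otimes>\<^bsub>\<Phi>\<^esub> inv\<^bsub>\<Phi>\<^esub> g" wd
  proof
    show "finite S" "finite S'" by fact+
    show "act i x \<in> carrier \<Phi> \<times> S'" if "i \<in> S" "x \<in> carrier \<Phi> \<times> S'" for i x
      using that Sc conj' by (auto simp: act_def)
    show "set (wd r) \<subseteq> S" if "r \<in> S'" for r using wd that by auto
    show "fold act (wd r) x = \<sigma> r x" if "r \<in> S'" "x \<in> carrier \<Phi> \<times> S'" for r x
      using wd that by (auto simp: \<sigma>_def)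
    show "bij_betw (\<lambda>r. i \<otimes>\<^bsub>\<Phi>\<^esub> r \<otimes>\<^bsub>\<Phi>\<^esub> inv\<^bsub>\<Phi>\<^esub> i) S' S'" if i: "i \<in> S" for i
    proof (rule bij_betwI[where g = "\<lambda>r. inv\<^bsub>\<Phi>\<^esub> i \<otimes>\<^bsub>\<Phi>\<^esub> r \<otimes>\<^bsub>\<Phi>\<^esub> i"])
    qed (use conj conj' Sc[OF i] S'c in \<open>auto simp: m_assoc cancel\<close>)
    show "\<sigma> r (act i x) = act i (\<sigma> (i \<otimes>\<^bsub>\<Phi>\<^esub> r \<otimes>\<^bsub>\<Phi>\<^esub> inv\<^bsub>\<Phi>\<^esub> i) x)"
      if "i \<in> S" "r \<in> S'" "x \<in> carrier \<Phi> \<times> S'" for i r x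
      using that Sc S'c by (auto simp: act_def \<sigma>_def m_assoc)
  qed
  define c where "c = T.gradient_const"
  have c0: "0 \<le> c" unfolding c_def by (rule T.gradient_const_nonneg)
  \<comment> \<open>One \<open>c^2 / t\<close> per generator comes from the linear term and one from
    the squared gradient; the summand 1 ensures positivity when these vanish.\<close>
  define C where "C = card S' * (2 * c\<^sup>2) + 1"
  show ?thesis
  proof (intro exI[of _ C] conjI allI impI ballI)
    show "C > 0" unfolding C_def by (simp add: add_nonneg_pos)
    fix w x and t :: real
    assume heat: "heat_solution (carrier \<Phi>) (cayley_graph \<Phi> S) w"
      and w01: "\<forall>x\<in>carrier \<Phi>. \<forall>t\<ge>0. w x t \<in> {0..1}"
      and x: "x \<in> carrier \<Phi>" and t: "0 < t"
    have der: "(w y has_real_derivative (\<Sum>s\<in>S. w (y \<otimes>\<^bsub>\<Phi>\<^esub> s) u - w y u)) (at u within {0..})"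
      if "y \<in> carrier \<Phi>" "u \<ge> 0" for y u
      using heat that laplacian_cayley_graph[OF S(1)] by (simp add: heat_solution_def)
    have heat1: "T.heat_defect (\<lambda>y. w (fst y)) (\<lambda>x t. 0)"
      unfolding T.heat_defect_def using der by (auto simp: act_def)
    have heat2: "T.heat_defect (\<lambda>y t. w (fst y \<otimes>\<^bsub>\<Phi>\<^esub> snd y) t - w (fst y) t) (\<lambda>x t. 0)"
      unfolding T.heat_defect_def
    proof (intro ballI allI impI)
      fix z and u :: real assume z: "z \<in> carrier \<Phi> \<times> S'" and u: "u \<ge> 0"
      obtain y s where ys: "z = (y, s)" "y \<in> carrier \<Phi>" "s \<in> S'" using z by auto
      have "y \<otimes>\<^bsub>\<Phi>\<^esub> g \<otimes>\<^bsub>\<Phi>\<^esub> (inv\<^bsub>\<Phi>\<^esub> g \<otimes>\<^bsub>\<Phi>\<^esub> s \<otimes>\<^bsub>\<Phi>\<^esub> g) = y \<otimes>\<^bsub>\<Phi>\<^esub> s \<otimes>\<^bsub>\<Phi>\<^esub> g" if "g \<in> S" for g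
        using Sc[OF that] ys S'c by (simp add: m_assoc cancel)
      then have "(\<Sum>g\<in>S. w (fst (act g z) \<otimes>\<^bsub>\<Phi>\<^esub> snd (act g z)) u - w (fst (act g z)) u
            - (w (fst z \<otimes>\<^bsub>\<Phi>\<^esub> snd z) u - w (fst z) u)) - 0
          = (\<Sum>g\<in>S. w (y \<otimes>\<^bsub>\<Phi>\<^esub> s \<otimes>\<^bsub>\<Phi>\<^esub> g) u - w (y \<otimes>\<^bsub>\<Phi>\<^esub> s) u) - (\<Sum>g\<in>S. w (y \<otimes>\<^bsub>\<Phi>\<^esub> g) u - w y u)"
        unfolding ys(1) by (simp add: act_def algebra_simps flip: sum_subtractf)
      moreover have "((\<lambda>u. w (y \<otimes>\<^bsub>\<Phi>\<^esub> s) u - w y u) has_real_derivative \<dots>) (at u within {0..})"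
        using ys u S'c by (intro DERIV_diff der) auto
      ultimately show "((\<lambda>t. w (fst z \<otimes>\<^bsub>\<Phi>\<^esub> snd z) t - w (fst z) t) has_real_derivative
          (\<Sum>g\<in>S. w (fst (act g z) \<otimes>\<^bsub>\<Phi>\<^esub> snd (act g z)) u - w (fst (act g z)) u
            - (w (fst z \<otimes>\<^bsub>\<Phi>\<^esub> snd z) u - w (fst z) u)) - 0) (at u within {0..})"
        unfolding ys(1) by simp
    qed
    have grad: "\<bar>w (y \<otimes>\<^bsub>\<Phi>\<^esub> s) u - w y u\<bar> \<le> c / sqrt u" if "y \<in> carrier \<Phi>" "s \<in> S'" "u > 0" for y s u
      using T.gradient_estimate[OF heat1, of 1 s "(y, s)" u] w01 that
      by (fastforce simp: \<sigma>_def c_def)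
    \<comment> \<open>At times from \<open>t / 2\<close> on, \<open>grad\<close> bounds the
      differences by \<open>c / sqrt (t / 2)\<close>. Taking this as \<open>B\<close> in the
      gradient estimate over the remaining time \<open>t / 2\<close> gives
      \<open>2 * c^2 / t\<close>.\<close>
    have grad2: "\<bar>(w (y \<otimes>\<^bsub>\<Phi>\<^esub> r \<otimes>\<^bsub>\<Phi>\<^esub> s) t - w (y \<otimes>\<^bsub>\<Phi>\<^esub> r) t) - (w (y \<otimes>\<^bsub>\<Phi>\<^esub> s) t - w y t)\<bar> \<le> 2 * c\<^sup>2 / t"
      if y: "y \<in> carrier \<Phi>" "r \<in> S'" "s \<in> S'" for y r s
    proof -
      have "\<bar>(w (y \<otimes>\<^bsub>\<Phi>\<^esub> r \<otimes>\<^bsub>\<Phi>\<^esub> s) t - w (y \<otimes>\<^bsub>\<Phi>\<^esub> r) t) - (w (y \<otimes>\<^bsub>\<Phi>\<^esub> s) t - w y t)\<bar>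
          \<le> c * (c / sqrt (t / 2)) / sqrt (t / 2)"
      proof -
        have "\<bar>w (fst z \<otimes>\<^bsub>\<Phi>\<^esub> snd z) (u + t / 2) - w (fst z) (u + t / 2)\<bar> \<le> c / sqrt (t / 2)"
          if "z \<in> carrier \<Phi> \<times> S'" "u \<ge> 0" for z u
        proof -
          have "\<bar>w (fst z \<otimes>\<^bsub>\<Phi>\<^esub> snd z) (u + t / 2) - w (fst z) (u + t / 2)\<bar> \<le> c / sqrt (u + t / 2)"
            using that t by (intro grad) auto
          also have "\<dots> \<le> c / sqrt (t / 2)"
            using that t c0 by (intro divide_left_mono) auto
          finally show ?thesis .
        qed
        from T.gradient_estimate[OF T.heat_defect_shift[OF heat2, of "t / 2"] this, of r "(y, s)" "t / 2"]
        show ?thesis using t y by (simp add: \<sigma>_def c_def)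
      qed
      also have "\<dots> = 2 * c\<^sup>2 / t" using t by (simp add: power2_eq_square field_simps)
      finally show ?thesis .
    qed
    define D where "D s = w (x \<otimes>\<^bsub>\<Phi>\<^esub> s) t - w x t" for s
    define a where "a = w x t + sqrt k"
    have wk: "1 \<le> w y t + sqrt k" if "y \<in> carrier \<Phi>" for y
    proof -
      have "1 \<le> sqrt k" using k by simp
      then show ?thesis using w01 that t by (auto simp: add_increasing)
    qed
    have symm: "(\<Sum>s\<in>S'. D (inv\<^bsub>\<Phi>\<^esub> s)) = (\<Sum>s\<in>S'. D s)"
      by (rule sum.reindex_bij_betw, rule bij_betwI[where g = "\<lambda>s. inv\<^bsub>\<Phi>\<^esub> s"]) (use S' S'c in auto)
    \<comment> \<open>Up to sign this is the mixed difference of \<open>grad2\<close> at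
      \<open>x\<close> with \<open>r\<close> the inverse of \<open>s\<close>, where one of the four
      points returns to \<open>x\<close>.\<close>
    have second: "\<bar>D s + D (inv\<^bsub>\<Phi>\<^esub> s)\<bar> \<le> 2 * c\<^sup>2 / t" if "s \<in> S'" for s
    proof -
      have "x \<otimes>\<^bsub>\<Phi>\<^esub> inv\<^bsub>\<Phi>\<^esub> s \<otimes>\<^bsub>\<Phi>\<^esub> s = x" using x S'c[OF that] by (simp add: m_assoc)
      then show ?thesis using grad2[OF x S'(2)[OF that] that] by (simp add: D_def abs_minus_commute)
    qed
    have "2 * - (\<Sum>s\<in>S'. D s) = (\<Sum>s\<in>S'. - (D s + D (inv\<^bsub>\<Phi>\<^esub> s)))"
      using symm by (simp add: sum.distrib sum_negf sum_subtractf)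
    also have "\<dots> \<le> card S' * (2 * c\<^sup>2 / t)"
      using second by (intro sum_bounded_above) (smt (verit))
    also have "\<dots> = 2 * (card S' * (c\<^sup>2 / t))" by simp
    finally have lap: "- (\<Sum>s\<in>S'. D s) \<le> card S' * (c\<^sup>2 / t)" by linarith
    have a: "1 \<le> a" unfolding a_def using wk[OF x] .
    have first: "- (\<Sum>s\<in>S'. D s) / a \<le> card S' * (c\<^sup>2 / t)"
    proof -
      have "- (\<Sum>s\<in>S'. D s) / a \<le> card S' * (c\<^sup>2 / t) / a"
        using lap a by (intro divide_right_mono) auto
      \<comment> \<open>The bound is nonnegative, so dividing it by \<open>a \<ge> 1\<close> only
        decreases it.\<close>
      also have "\<dots> \<le> card S' * (c\<^sup>2 / t)"
        using a t divide_left_mono[of 1 a "card S' * (c\<^sup>2 / t)"] by simp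
      finally show ?thesis .
    qed
    have square: "(\<Sum>s\<in>S'. (D s)\<^sup>2) \<le> card S' * (c\<^sup>2 / t)"
    proof (rule sum_bounded_above)
      fix s assume "s \<in> S'"
      then have "\<bar>D s\<bar> \<le> c / sqrt t" unfolding D_def using grad x t by blast
      then have "(D s)\<^sup>2 \<le> (c / sqrt t)\<^sup>2" by (metis abs_ge_zero power2_abs power_mono)
      then show "(D s)\<^sup>2 \<le> c\<^sup>2 / t" using t by (simp add: power_divide)
    qed
    have "- laplacian (cayley_graph \<Phi> S') (\<lambda>y. ln (w y t + sqrt (real k))) x
        \<le> - (\<Sum>s\<in>S'. D s) / a + (\<Sum>s\<in>S'. (D s)\<^sup>2)"
    proof -
      have "- laplacian (cayley_graph \<Phi> S') (\<lambda>y. ln (w y t + sqrt (real k))) x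
          = (\<Sum>s\<in>S'. ln a - ln (w (x \<otimes>\<^bsub>\<Phi>\<^esub> s) t + sqrt k))"
        using laplacian_cayley_graph[OF S'(1) x] by (simp add: a_def sum_subtractf)
      also have "\<dots> \<le> (\<Sum>s\<in>S'. - D s / a + (D s)\<^sup>2)"
      proof (rule sum_mono)
        fix s assume "s \<in> S'"
        then have "1 \<le> w (x \<otimes>\<^bsub>\<Phi>\<^esub> s) t + sqrt k" using wk x S'c by simp
        from ln_diff_le[OF a this] show "ln a - ln (w (x \<otimes>\<^bsub>\<Phi>\<^esub> s) t + sqrt k) \<le> - D s / a + (D s)\<^sup>2"
          by (simp add: a_def D_def)
      qed
      also have "\<dots> = - (\<Sum>s\<in>S'. D s) / a + (\<Sum>s\<in>S'. (D s)\<^sup>2)"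
        by (simp add: sum.distrib sum_divide_distrib sum_negf sum_subtractf)
      finally show ?thesis .
    qed
    also have "\<dots> \<le> card S' * (c\<^sup>2 / t) + card S' * (c\<^sup>2 / t)" by (rule add_mono[OF first square])
    also have "\<dots> = card S' * (2 * c\<^sup>2) / t" by simp
    also have "\<dots> \<le> C / t" using t by (intro divide_right_mono) (auto simp: C_def)
    finally show "- laplacian (cayley_graph \<Phi> S') (\<lambda>y. ln (w y t + sqrt (real k))) x \<le> C / t" .
  qed
qed

end
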